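(* Let $(X,d)$ be a compact metric space and let $k$ be a positive integer. If the Hausdorff dimension of $X$ satisfies $\dim_H X>k$, then there exists a Lipschitz map $f:X\to\mathbb{R}^k$ with $f(X)=[0,1]^k$. *)

theory Defs
  imports "HOL-Analysis.Analysis"
begin

definition diam_pow :: "real \<Rightarrow> 'a::metric_space set \<Rightarrow> ennreal" where
  "diam_pow s U = (if U = {} then 0 else if s = 0 then 1 else ennreal (diameter U powr s))"

definition hausdorff_pre :: "real \<Rightarrow> real \<Rightarrow> 'a::metric_space set \<Rightarrow> ennreal" where
  "hausdorff_pre s \<delta> A =
     (INF U \<in> {U :: nat \<Rightarrow> 'a set. A \<subseteq> (\<Union>i. U i) \<and>
                 (\<forall>i. bounded (U i) \<and> diameter (U i) \<le> \<delta>)}.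
        (\<Sum>i. diam_pow s (U i)))"

definition hausdorff_measure :: "real \<Rightarrow> 'a::metric_space set \<Rightarrow> ennreal" where
  "hausdorff_measure s A = (SUP \<delta> \<in> {0<..}. hausdorff_pre s \<delta> A)"

definition hausdorff_dim :: "'a::metric_space set \<Rightarrow> ereal" where
  "hausdorff_dim A = Inf {ereal s | s. 0 \<le> s \<and> hausdorff_measure s A = 0}"

end

theory Submission
  imports Defs "HOL-Complex_Analysis.Great_Picard"
begin

text \<open>
  Fix \<open>s\<close> with \<open>k < s < dim X\<close>, so that the \<open>s\<close>-dimensional content of \<open>X\<close> is positive, and \<open>t\<close> with
  \<open>p = s (1 - 1/t) > k\<close>. Every finite net of \<open>X\<close> is thinned out scale by scale: at scale \<open>r\<close> one
  repeatedly picks the ball of radius \<open>r/2\<close> of largest content and, among \<open>t\<close> concentric enlargements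
  inside the ball of radius \<open>r\<close>, discards the annulus across which the content grows least. The
  surviving pieces are \<open>r/(2t)\<close>-separated, and the loss telescopes over the scales, because the
  lower bound \<open>w(A) / (max\<^sub>x w(A \<inter> B(x,r)))\<^bsup>1/t\<^esup>\<close> is inherited from scale \<open>r/2\<close> to scale \<open>r\<close>. Laying
  the pieces out along a line yields maps \<open>g\<close> on finite subsets of \<open>X\<close> with
  \<open>\<bar>g x - g y\<bar> \<le> C d(x,y)\<^sup>p\<close> whose images are arbitrarily dense in a fixed interval. Composing with a
  \<open>1/p\<close>-Hoelder map of the line onto the cube, which exists because \<open>p > k\<close>, gives equi-Lipschitz maps
  with arbitrarily dense image in the cube; a limit of them is onto.
\<close>

section \<open>Separated pieces laid out along a segment\<close>

text \<open>The domain \<open>F\<close> is any subset of \<open>A\<close>, so points may be thrown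
  away at every stage. Density is asked only on the half-open segment: for \<open>v <= 0\<close> the
  empty \<open>F\<close> does, and two segments can be joined end to end.\<close>

definition segment_map_on :: "real \<Rightarrow> real \<Rightarrow> real \<Rightarrow> 'a::metric_space set \<Rightarrow> real \<Rightarrow> bool" where
  "segment_map_on C p \<epsilon> A v \<longleftrightarrow>
     (\<exists>F g. F \<subseteq> A \<and> g ` F \<subseteq> {0..v} \<and>
            (\<forall>x\<in>F. \<forall>y\<in>F. \<bar>g x - g y\<bar> \<le> C * dist x y powr p) \<and>
            (\<forall>u\<in>{0..<v}. \<exists>x\<in>F. \<bar>g x - u\<bar> \<le> \<epsilon>))"

lemma segment_map_on_nonpos: "v \<le> 0 \<Longrightarrow> segment_map_on C p \<epsilon> A v"
  unfolding segment_map_on_def by (rule exI[of _ "{}"]) auto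

lemma segment_map_on_const:
  assumes "a \<in> A" "v \<le> \<epsilon>"
  shows "segment_map_on C p \<epsilon> A v"
proof (cases "v \<le> 0")
  case False
  then show ?thesis
    unfolding segment_map_on_def using assms
    by (intro exI[of _ "{a}"] exI[of _ "\<lambda>_. 0"]) auto
qed (rule segment_map_on_nonpos)

text \<open>Truncating \<open>g\<close> at \<open>v'\<close> is 1-Lipschitz and moves no value away
  from a target below \<open>v'\<close>.\<close>

lemma segment_map_on_mono:
  assumes "segment_map_on C p \<epsilon> A v" "v' \<le> v" "A \<subseteq> A'" "\<epsilon> \<le> \<epsilon>'"
  shows "segment_map_on C p \<epsilon>' A' v'"
proof (cases "v' \<le> 0")
  case False
  obtain F g where F: "F \<subseteq> A" "g ` F \<subseteq> {0..v}"
      "\<And>x y. x \<in> F \<Longrightarrow> y \<in> F \<Longrightarrow> \<bar>g x - g y\<bar> \<le> C * dist x y powr p"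
      "\<And>u. u \<in> {0..<v} \<Longrightarrow> \<exists>x\<in>F. \<bar>g x - u\<bar> \<le> \<epsilon>"
    using assms(1) unfolding segment_map_on_def by metis
  have "\<exists>x\<in>F. \<bar>min (g x) v' - u\<bar> \<le> \<epsilon>'" if u: "u \<in> {0..<v'}" for u
  proof -
    obtain x where x: "x \<in> F" "\<bar>g x - u\<bar> \<le> \<epsilon>" using F(4)[of u] u assms(2) by auto
    then have "\<bar>min (g x) v' - u\<bar> \<le> \<epsilon>'" using u assms(4) by (auto simp: min_def)
    with x(1) show ?thesis by blast
  qed
  moreover have "\<bar>min (g x) v' - min (g y) v'\<bar> \<le> C * dist x y powr p" if "x \<in> F" "y \<in> F" for x y
    using F(3)[OF that] by (auto simp: min_def)
  ultimately show ?thesis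
    unfolding segment_map_on_def using F(1,2) assms(3) False
    by (intro exI[of _ F] exI[of _ "\<lambda>x. min (g x) v'"]) (auto simp: image_subset_iff)
qed (rule segment_map_on_nonpos)

text \<open>The second image is shifted by \<open>v1\<close> to follow the first, and the union is
  truncated at \<open>v\<close>. Any two values then differ by at most \<open>v\<close>, which the
  gap \<open>\<eta>\<close> between \<open>P\<close> and \<open>Q\<close> pays for.\<close>

lemma segment_map_on_concat:
  assumes "segment_map_on C p \<epsilon> P v1" "segment_map_on C p \<epsilon> Q v2"
    and sep: "\<And>x y. x \<in> P \<Longrightarrow> y \<in> Q \<Longrightarrow> \<eta> < dist x y"
    and pos: "0 < \<eta>" "0 \<le> C" "0 \<le> p" "0 \<le> v1" "0 \<le> v2"
    and v: "v \<le> v1 + v2" "v \<le> C * \<eta> powr p"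
  shows "segment_map_on C p \<epsilon> (P \<union> Q) v"
proof (cases "v \<le> 0")
  case False
  obtain F g where F: "F \<subseteq> P" "g ` F \<subseteq> {0..v1}"
      "\<And>x y. x \<in> F \<Longrightarrow> y \<in> F \<Longrightarrow> \<bar>g x - g y\<bar> \<le> C * dist x y powr p"
      "\<And>u. u \<in> {0..<v1} \<Longrightarrow> \<exists>x\<in>F. \<bar>g x - u\<bar> \<le> \<epsilon>"
    using assms(1) unfolding segment_map_on_def by metis
  obtain G h where G: "G \<subseteq> Q" "h ` G \<subseteq> {0..v2}"
      "\<And>x y. x \<in> G \<Longrightarrow> y \<in> G \<Longrightarrow> \<bar>h x - h y\<bar> \<le> C * dist x y powr p"
      "\<And>u. u \<in> {0..<v2} \<Longrightarrow> \<exists>x\<in>G. \<bar>h x - u\<bar> \<le> \<epsilon>"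
    using assms(2) unfolding segment_map_on_def by metis
  define e where "e x = min v (if x \<in> F then g x else v1 + h x)" for x
  have disj: "x \<notin> F" if "x \<in> G" for x
    using sep[of x x] that F(1) G(1) pos(1) by fastforce
  have range: "e x \<in> {0..v}" if "x \<in> F \<union> G" for x
    using that F(2) G(2) False pos by (auto simp: e_def image_subset_iff min_def split: if_splits)
  have cross: "\<bar>e x - e y\<bar> \<le> C * dist x y powr p" if "x \<in> F" "y \<in> G" for x y
  proof -
    have "\<bar>e x - e y\<bar> \<le> v" using range[of x] range[of y] that by auto
    also have "\<dots> \<le> C * \<eta> powr p" by fact
    also have "\<dots> \<le> C * dist x y powr p"
      using sep[of x y] that F(1) G(1) pos by (intro mult_left_mono powr_mono2) (auto intro: less_imp_le)
    finally show ?thesis .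
  qed
  have holder: "\<bar>e x - e y\<bar> \<le> C * dist x y powr p" if xy: "x \<in> F \<union> G" "y \<in> F \<union> G" for x y
  proof -
    consider "x \<in> F" "y \<in> F" | "x \<in> G" "y \<in> G" | "x \<in> F" "y \<in> G" | "x \<in> G" "y \<in> F"
      using xy by blast
    then show ?thesis
    proof cases
      case 1
      then have "\<bar>e x - e y\<bar> \<le> \<bar>g x - g y\<bar>" by (auto simp: e_def min_def)
      then show ?thesis using F(3)[OF 1] by linarith
    next
      case 2
      then have "\<bar>e x - e y\<bar> \<le> \<bar>h x - h y\<bar>" using disj by (auto simp: e_def min_def)
      then show ?thesis using G(3)[OF 2] by linarith
    next
      case 3
      then show ?thesis by (rule cross)
    next
      case 4
      then show ?thesis using cross[of y x] by (simp add: dist_commute abs_minus_commute)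
    qed
  qed
  have dense: "\<exists>x\<in>F \<union> G. \<bar>e x - u\<bar> \<le> \<epsilon>" if u: "u \<in> {0..<v}" for u
  proof (cases "u < v1")
    case True
    then obtain x where x: "x \<in> F" "\<bar>g x - u\<bar> \<le> \<epsilon>" using F(4)[of u] u by auto
    then have "\<bar>e x - u\<bar> \<le> \<epsilon>" using u by (auto simp: e_def min_def)
    with x(1) show ?thesis by blast
  next
    case False
    then obtain x where x: "x \<in> G" "\<bar>h x - (u - v1)\<bar> \<le> \<epsilon>" using G(4)[of "u - v1"] u v(1) by auto
    then have "\<bar>e x - u\<bar> \<le> \<epsilon>" using u disj by (auto simp: e_def min_def)
    with x(1) show ?thesis by blast
  qed
  show ?thesis
    unfolding segment_map_on_def using F(1) G(1) range holder dense
    by (intro exI[of _ "F \<union> G"] exI[of _ e]) (auto simp: image_subset_iff)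
qed (rule segment_map_on_nonpos)

section \<open>Thinning out a finite set scale by scale\<close>

lemma slow_growth_step:
  fixes q :: "nat \<Rightarrow> real"
  assumes "0 < t" "0 < q 0" "q t \<le> W"
  shows "\<exists>i<t. q (Suc i) \<le> q i * (W / q 0) powr (1 / real t)"
proof (rule ccontr)
  assume neg: "\<not> ?thesis"
  \<comment> \<open>If all \<open>t\<close> steps grew by more than this factor, their product would
    exceed \<open>W / q 0\<close>.\<close>
  define \<rho> where "\<rho> = (W / q 0) powr (1 / real t)"
  have grow: "q i * \<rho> < q (Suc i)" if "i < t" for i
    using neg that by (auto simp: \<rho>_def not_le)
  have low: "q 0 * \<rho> ^ i \<le> q i" if "i \<le> t" for i
    using that
  proof (induction i)
    case (Suc i)
    have "q 0 * \<rho> ^ Suc i = q 0 * \<rho> ^ i * \<rho>" by simp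
    also have "\<dots> \<le> q i * \<rho>" using Suc by (intro mult_right_mono) (auto simp: \<rho>_def)
    also have "\<dots> \<le> q (Suc i)" using grow[of i] Suc.prems by simp
    finally show ?case .
  qed simp
  \<comment> \<open>The last step is split off because \<open>low\<close> alone would lose the
    strict inequality.\<close>
  obtain j where j: "t = Suc j" using assms(1) gr0_implies_Suc by blast
  have "q 0 * \<rho> ^ t = q 0 * \<rho> ^ j * \<rho>" by (simp add: j)
  also have "\<dots> \<le> q j * \<rho>" using low[of j] j by (intro mult_right_mono) (auto simp: \<rho>_def)
  also have "\<dots> < q t" using grow[of j] j by simp
  also have "\<dots> \<le> W" by fact
  finally have lt: "q 0 * \<rho> ^ t < W" .
  have "0 \<le> \<rho> ^ t" by (simp add: \<rho>_def)
  with lt assms(2) have "0 < W" by (smt (verit) mult_nonneg_nonneg)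
  then have "\<rho> ^ t = W / q 0"
    unfolding \<rho>_def using assms by (subst powr_realpow[symmetric]) (auto simp: powr_powr)
  with lt assms(2) show False by simp
qed

text \<open>The cap \<open>(2r)\<^sup>p\<close> keeps the glued map Hoelder across pieces at scale \<open>r\<close>. It never destroys
  the lower bound: a piece together with its discarded annulus lies in one ball of radius \<open>r\<close>, so it is only owed
  \<open>W\<^bsup>1-1/t\<^esup> \<le> r\<^sup>p\<close>, which is the cap one scale below.\<close>
lemma segment_map_on_finite:
  fixes N :: "'a::metric_space set" and w :: "'a set \<Rightarrow> real"
  assumes "finite N" and \<delta>: "0 < \<delta>" and t: "0 < t" and s: "0 < s"
    and w_empty: "w {} = 0"
    and w_pos: "\<And>A. A \<subseteq> N \<Longrightarrow> A \<noteq> {} \<Longrightarrow> 0 < w A"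
    and w_mono: "\<And>A B. A \<subseteq> B \<Longrightarrow> B \<subseteq> N \<Longrightarrow> w A \<le> w B"
    and w_subadd: "\<And>A B. A \<subseteq> N \<Longrightarrow> B \<subseteq> N \<Longrightarrow> w (A \<union> B) \<le> w A + w B"
    and w_ball: "\<And>x r. \<delta> \<le> r \<Longrightarrow> w (N \<inter> cball x r) \<le> r powr s"
    and p: "p = s * (1 - 1 / real t)"
    and A: "A \<subseteq> N" and r: "r = 2 ^ m * \<delta>"
    and W: "0 < W" "W \<le> r powr s" "\<And>x. x \<in> A \<Longrightarrow> w (A \<inter> cball x r) \<le> W"
  shows "segment_map_on ((4 * real t) powr p) p ((2 * \<delta>) powr p) A
           (min ((2 * r) powr p) (w A / W powr (1 / real t)))"
  using A r W
proof (induction m arbitrary: A r W)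
  case 0
  show ?case
  proof (cases "A = {}")
    case True
    then show ?thesis by (intro segment_map_on_nonpos) (simp add: w_empty)
  next
    case False
    then obtain a where "a \<in> A" by blast
    \<comment> \<open>At the bottom scale the cap \<open>(2 * r) powr p\<close> equals the
      tolerance, so a constant map on one point is dense enough.\<close>
    then show ?thesis using 0 by (intro segment_map_on_const) auto
  qed
next
  case (Suc m)
  have r_pos: "0 < r" using Suc.prems(2) \<delta> by simp
  have p0: "0 \<le> p" using t s by (simp add: p)
  define r' where "r' = r / 2"
  have r': "r' = 2 ^ m * \<delta>" "0 < r'" "\<delta> \<le> r'"
    using Suc.prems(2) \<delta> by (auto simp: r'_def mult_le_cancel_right2)
  let ?C = "(4 * real t) powr p" and ?\<epsilon> = "(2 * \<delta>) powr p"
  let ?a = "1 / real t"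
  \<comment> \<open>Inner induction on the part \<open>R\<close> still to be laid out, with
    \<open>r\<close> and \<open>W\<close> fixed. Each step splits off a piece \<open>P\<close>,
    treated at scale \<open>r'\<close> by the outer hypothesis, and leaves a smaller remainder
    \<open>Q\<close> at scale \<open>r\<close>.\<close>
  have "finite R \<Longrightarrow> R \<subseteq> A \<Longrightarrow> segment_map_on ?C p ?\<epsilon> R (min ((2 * r) powr p) (w R / W powr ?a))" for R
  proof (induction R rule: finite_psubset_induct)
    case (psubset R)
    show ?case
    proof (cases "R = {}")
      case True
      then show ?thesis by (intro segment_map_on_nonpos) (simp add: w_empty)
    next
      case False
      have RN: "R \<subseteq> N" using psubset.prems Suc.prems(1) by blast
      \<comment> \<open>Maximality at \<open>c\<close> makes \<open>q 0\<close> an admissible value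
        of \<open>W\<close> for the piece \<open>P\<close> one scale down.\<close>
      obtain c where c: "c \<in> R" "\<And>x. x \<in> R \<Longrightarrow> w (R \<inter> cball x r') \<le> w (R \<inter> cball c r')"
      proof -
        let ?S = "(\<lambda>x. w (R \<inter> cball x r')) ` R"
        have "Max ?S \<in> ?S" using psubset.hyps(1) False by (intro Max_in) auto
        then obtain c where "c \<in> R" "w (R \<inter> cball c r') = Max ?S" by auto
        then show thesis using psubset.hyps(1) by (intro that[of c]) auto
      qed
      define \<rho> where "\<rho> i = r' + real i * (r' / real t)" for i
      define q where "q i = w (R \<inter> cball c (\<rho> i))" for i
      have q0: "q 0 = w (R \<inter> cball c r')" by (simp add: q_def \<rho>_def)
      have q0_pos: "0 < q 0"
        unfolding q0 using c(1) RN r'(2) by (intro w_pos) auto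
      have \<rho>t: "\<rho> t = r" using t by (simp add: \<rho>_def r'_def)
      have sub: "w B \<le> w B'" if "B \<subseteq> B'" "B' \<subseteq> R" for B B'
        using that RN by (intro w_mono) auto
      have ball_W: "w (R \<inter> cball c r) \<le> W"
      proof -
        have "w (R \<inter> cball c r) \<le> w (A \<inter> cball c r)"
          using psubset.prems Suc.prems(1) by (intro w_mono) auto
        also have "\<dots> \<le> W" using Suc.prems(5)[of c] c(1) psubset.prems by auto
        finally show ?thesis .
      qed
      then have "q t \<le> W" by (simp add: q_def \<rho>t)
      then obtain i where i: "i < t" "q (Suc i) \<le> q i * (W / q 0) powr ?a"
        using slow_growth_step[of t q W] t q0_pos by auto
      \<comment> \<open>The annulus between the radii \<open>\<rho> i\<close> and
        \<open>\<rho> (Suc i)\<close> is dropped, which keeps \<open>P\<close> and \<open>Q\<close>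
        more than \<open>r' / t\<close> apart.\<close>
      define P where "P = R \<inter> cball c (\<rho> i)"
      define Q where "Q = R - cball c (\<rho> (Suc i))"
      have \<rho>_mono: "\<rho> j \<le> \<rho> k" if "j \<le> k" for j k
        using that r'(2) by (auto simp: \<rho>_def intro!: divide_right_mono mult_right_mono)
      have "\<rho> 0 \<le> \<rho> (Suc i)" by (intro \<rho>_mono) auto
      then have "c \<notin> Q" using r'(2) by (auto simp: Q_def \<rho>_def)
      moreover have "Q \<subseteq> R" by (auto simp: Q_def)
      ultimately have "Q \<subset> R" using c(1) by blast
      then have segQ: "segment_map_on ?C p ?\<epsilon> Q (min ((2 * r) powr p) (w Q / W powr ?a))"
        using psubset.IH[of Q] psubset.prems by auto
      have segP: "segment_map_on ?C p ?\<epsilon> P (min ((2 * r') powr p) (w P / q 0 powr ?a))"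
      proof (rule Suc.IH[OF _ r'(1) q0_pos])
        show "P \<subseteq> N" using RN by (auto simp: P_def)
        have "q 0 \<le> w (N \<inter> cball c r')" unfolding q0 using RN by (intro w_mono) auto
        also have "\<dots> \<le> r' powr s" using r' by (intro w_ball)
        finally show "q 0 \<le> r' powr s" .
        show "w (P \<inter> cball x r') \<le> q 0" if "x \<in> P" for x
        proof -
          have "w (P \<inter> cball x r') \<le> w (R \<inter> cball x r')" by (intro sub) (auto simp: P_def)
          also have "\<dots> \<le> q 0" unfolding q0 using that by (intro c(2)) (auto simp: P_def)
          finally show ?thesis .
        qed
      qed
      \<comment> \<open>\<open>P\<close> is credited with the content of the dropped annulus as
        well, so that the values of \<open>P\<close> and \<open>Q\<close> still add up to that of
        \<open>R\<close>.\<close>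
      define v where "v = q (Suc i) / W powr ?a"
      have Wa: "0 < W powr ?a" using Suc.prems(3) by simp
      have "v \<le> (2 * r') powr p"
      proof -
        have "q (Suc i) \<le> w (R \<inter> cball c r)"
          unfolding q_def using \<rho>_mono[of "Suc i" t] i(1) \<rho>t by (intro sub) auto
        then have "v \<le> W / W powr ?a" unfolding v_def using ball_W by (intro divide_right_mono) auto
        also have "\<dots> = W powr (1 - ?a)" using Suc.prems(3) by (simp add: powr_diff)
        also have "\<dots> \<le> (r powr s) powr (1 - ?a)"
          using Suc.prems(3,4) t by (intro powr_mono2) auto
        also have "\<dots> = (2 * r') powr p" by (simp add: powr_powr p r'_def)
        finally show ?thesis .
      qed
      \<comment> \<open>The slow growth factor is exactly what exchanges the normaliser
        \<open>W\<close> for \<open>q 0\<close>.\<close>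
      moreover have "v \<le> w P / q 0 powr ?a"
      proof -
        have "v \<le> q i * (W / q 0) powr ?a / W powr ?a"
          unfolding v_def using i(2) by (intro divide_right_mono) auto
        also have "\<dots> = w P / q 0 powr ?a"
          using Suc.prems(3) q0_pos by (simp add: powr_divide q_def P_def)
        finally show ?thesis .
      qed
      ultimately have segP': "segment_map_on ?C p ?\<epsilon> P v"
        by (intro segment_map_on_mono[OF segP]) auto
      have wR: "w R \<le> q (Suc i) + w Q"
      proof -
        have "R = (R \<inter> cball c (\<rho> (Suc i))) \<union> Q" by (auto simp: Q_def)
        then show ?thesis
          unfolding q_def using w_subadd[of "R \<inter> cball c (\<rho> (Suc i))" Q] RN by (auto simp: Q_def)
      qed
      have w_nonneg: "0 \<le> w B" if "B \<subseteq> R" for B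
        using sub[of "{}" B] that w_empty by simp
      have v0: "0 \<le> v" unfolding v_def q_def using Wa w_nonneg by (intro divide_nonneg_pos) auto
      have "segment_map_on ?C p ?\<epsilon> (P \<union> Q) (min ((2 * r) powr p) (w R / W powr ?a))"
      proof (rule segment_map_on_concat[OF segP' segQ, where \<eta> = "r' / real t"])
        show "r' / real t < dist x y" if "x \<in> P" "y \<in> Q" for x y
        proof -
          have "dist c x \<le> \<rho> i" "\<rho> (Suc i) < dist c y" using that by (auto simp: P_def Q_def)
          moreover have "dist c y \<le> dist c x + dist x y" by (rule dist_triangle)
          moreover have "\<rho> (Suc i) = \<rho> i + r' / real t"
            by (simp add: \<rho>_def algebra_simps add_divide_distrib)
          ultimately show ?thesis by linarith
        qed
        have "w R / W powr ?a \<le> v + w Q / W powr ?a"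
          using wR Wa by (simp add: v_def add_divide_distrib[symmetric] divide_right_mono)
        then show "min ((2 * r) powr p) (w R / W powr ?a) \<le> v + min ((2 * r) powr p) (w Q / W powr ?a)"
          using v0 by (auto simp: min_def)
        \<comment> \<open>Since \<open>r = 2 * r'\<close>, the constant \<open>4 * t\<close> turns
          the gap \<open>r' / t\<close> into \<open>2 * r\<close>, so the cap is what the gap
          allows.\<close>
        have "(2 * r) powr p = ?C * (r' / real t) powr p"
          using t r_pos by (simp add: powr_mult[symmetric] r'_def)
        then show "min ((2 * r) powr p) (w R / W powr ?a) \<le> ?C * (r' / real t) powr p" by simp
        show "0 \<le> min ((2 * r) powr p) (w Q / W powr ?a)"
          using w_nonneg[of Q] Wa by (auto simp: Q_def)
      qed (use r' t p0 v0 in auto)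
      then show ?thesis
        by (rule segment_map_on_mono) (auto simp: P_def Q_def)
    qed
  qed
  then show ?case using Suc.prems(1) \<open>finite N\<close> finite_subset by blast
qed

section \<open>Content with a lower bound on the radii\<close>

text \<open>Positive measure forces positive content: a cover by balls with a very small sum
  consists of very small balls, hence competes in \<open>hausdorff_pre\<close> at some fixed
  \<open>\<delta>\<close> where that value is nonzero.\<close>

lemma ball_cover_sum_bounded_below:
  fixes X :: "'a::metric_space set"
  assumes "0 < s" "hausdorff_measure s X \<noteq> 0"
  shows "\<exists>\<kappa>>0. \<forall>I. finite I \<longrightarrow> (\<forall>(x, r)\<in>I. 0 < r) \<longrightarrow> X \<subseteq> (\<Union>(x, r)\<in>I. cball x r) \<longrightarrow>
           \<kappa> \<le> (\<Sum>(x, r)\<in>I. r powr s)"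
proof -
  obtain \<delta> where \<delta>: "0 < \<delta>" "hausdorff_pre s \<delta> X \<noteq> 0"
    using assms(2) unfolding hausdorff_measure_def
    by (metis (no_types, lifting) SUP_bot_conv(1) bot_ennreal greaterThan_iff)
  obtain e where e: "0 < e" "ennreal e \<le> hausdorff_pre s \<delta> X"
  proof (cases "hausdorff_pre s \<delta> X")
    case (real r)
    then show thesis using \<delta>(2) that[of r] by (cases "r = 0") auto
  next
    case top
    then show thesis using that[of 1] by simp
  qed
  \<comment> \<open>The first term forces all radii below \<open>\<delta> / 2\<close>; the second
    absorbs the factor \<open>2 powr s\<close> from replacing radii by diameters.\<close>
  define \<kappa> where "\<kappa> = min ((\<delta> / 2) powr s) (e / 2 powr s)"
  have "\<kappa> \<le> (\<Sum>(x, r)\<in>I. r powr s)"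
    if I: "finite I" "\<forall>(x, r)\<in>I. 0 < r" "X \<subseteq> (\<Union>(x, r)\<in>I. cball x r)" for I
  proof (rule ccontr)
    assume "\<not> ?thesis"
    then have small: "(\<Sum>(x, r)\<in>I. r powr s) < \<kappa>" by simp
    have rad: "r < \<delta> / 2" if "(x, r) \<in> I" for x r
    proof -
      have "r powr s \<le> (\<Sum>(x, r)\<in>I. r powr s)"
        using member_le_sum[of "(x, r)" I "\<lambda>(x, r). r powr s"] that I(1) by auto
      also have "\<dots> < (\<delta> / 2) powr s" using small by (simp add: \<kappa>_def)
      finally show ?thesis using assms(1) \<delta>(1) I(2) that
        by (metis (no_types, lifting) not_le powr_mono2 less_imp_le half_gt_zero)
    qed
    obtain f where f: "bij_betw f {..<card I} I"
      using ex_bij_betw_nat_finite[OF I(1)] atLeast0LessThan by auto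
    \<comment> \<open>The finite family is padded with empty sets, to which \<open>diam_pow\<close>
      gives the value 0.\<close>
    define U where "U i = (if i < card I then cball (fst (f i)) (snd (f i)) else {})" for i
    have fI: "(fst (f i), snd (f i)) \<in> I" if "i < card I" for i
      using f that by (auto dest: bij_betwE)
    have bd: "diameter (cball x r) \<le> 2 * r" if "0 < r" for x :: 'a and r
    proof -
      have "dist y z \<le> 2 * r" if "y \<in> cball x r" "z \<in> cball x r" for y z
        using that dist_triangle[of y z x] by (auto simp: dist_commute)
      then show ?thesis
        unfolding diameter_def using that by (auto intro!: cSUP_least)
    qed
    have "U \<in> {U. X \<subseteq> (\<Union>i. U i) \<and> (\<forall>i. bounded (U i) \<and> diameter (U i) \<le> \<delta>)}"
    proof -
      have "X \<subseteq> (\<Union>i. U i)"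
      proof
        fix y assume "y \<in> X"
        then obtain x r where xr: "(x, r) \<in> I" "y \<in> cball x r" using I(3) by auto
        then obtain i where "i < card I" "f i = (x, r)"
          using f by (metis bij_betw_iff_bijections lessThan_iff)
        then show "y \<in> (\<Union>i. U i)" using xr(2) by (auto simp: U_def)
      qed
      moreover have "diameter (U i) \<le> \<delta>" for i
        using bd[of "snd (f i)" "fst (f i)"] rad[OF fI[of i]] fI[of i] I(2) \<delta>(1)
        by (fastforce simp: U_def)
      ultimately show ?thesis by (auto simp: U_def)
    qed
    then have "hausdorff_pre s \<delta> X \<le> (\<Sum>i. diam_pow s (U i))"
      unfolding hausdorff_pre_def by (rule INF_lower)
    also have "\<dots> = (\<Sum>i<card I. diam_pow s (U i))"
      by (rule suminf_finite) (auto simp: U_def diam_pow_def)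
    also have "\<dots> \<le> (\<Sum>i<card I. ennreal ((2 * snd (f i)) powr s))"
    proof (rule sum_mono)
      fix i assume "i \<in> {..<card I}"
      then have i: "i < card I" "0 < snd (f i)" using fI[of i] I(2) by auto
      have "diameter (U i) powr s \<le> (2 * snd (f i)) powr s"
        using bd[OF i(2)] i assms(1) by (intro powr_mono2 diameter_ge_0) (auto simp: U_def)
      then show "diam_pow s (U i) \<le> ennreal ((2 * snd (f i)) powr s)"
        using assms(1) by (auto simp: diam_pow_def intro: ennreal_leI)
    qed
    also have "\<dots> = ennreal (\<Sum>i<card I. (2 * snd (f i)) powr s)" by (rule sum_ennreal) simp
    also have "(\<Sum>i<card I. (2 * snd (f i)) powr s) = (\<Sum>z\<in>I. (2 * snd z) powr s)"
      by (rule sum.reindex_bij_betw[OF f])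
    also have "\<dots> = 2 powr s * (\<Sum>(x, r)\<in>I. r powr s)"
      unfolding sum_distrib_left using I(2) by (intro sum.cong) (auto simp: powr_mult)
    also have "ennreal \<dots> < ennreal e"
      using small e(1) by (intro ennreal_lessI) (auto simp: \<kappa>_def field_simps)
    finally show False using e(2) by simp
  qed
  then show ?thesis using \<delta>(1) e(1) by (intro exI[of _ \<kappa>]) (auto simp: \<kappa>_def)
qed

text \<open>This is Hausdorff content with balls restricted to radius at least
  \<open>\<delta>\<close>. Unrestricted content vanishes on finite sets for \<open>s > 0\<close>;
  the restriction keeps it at least \<open>\<delta> powr s\<close> on nonempty ones.\<close>

definition coarse_content :: "real \<Rightarrow> real \<Rightarrow> 'a::metric_space set \<Rightarrow> real" where
  "coarse_content s \<delta> A =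
     Inf {(\<Sum>(x, r)\<in>I. r powr s) | I.
            finite I \<and> (\<forall>(x, r)\<in>I. \<delta> \<le> r) \<and> A \<subseteq> (\<Union>(x, r)\<in>I. cball x r)}"

lemma coarse_content_le:
  assumes "finite I" "\<forall>(x, r)\<in>I. \<delta> \<le> r" "A \<subseteq> (\<Union>(x, r)\<in>I. cball x r)"
  shows "coarse_content s \<delta> A \<le> (\<Sum>(x, r)\<in>I. r powr s)"
  unfolding coarse_content_def
proof (rule cInf_lower)
  show "bdd_below {(\<Sum>(x, r)\<in>I. r powr s) | I.
            finite I \<and> (\<forall>(x, r)\<in>I. \<delta> \<le> r) \<and> A \<subseteq> (\<Union>(x, r)\<in>I. cball x r)}"
    by (intro bdd_belowI[of _ 0]) (auto intro!: sum_nonneg)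
qed (use assms in blast)

lemma coarse_content_greatest:
  assumes "finite A" "0 < \<delta>"
    and "\<And>I. finite I \<Longrightarrow> \<forall>(x, r)\<in>I. \<delta> \<le> r \<Longrightarrow> A \<subseteq> (\<Union>(x, r)\<in>I. cball x r) \<Longrightarrow>
           c \<le> (\<Sum>(x, r)\<in>I. r powr s)"
  shows "c \<le> coarse_content s \<delta> A"
  unfolding coarse_content_def
proof (rule cInf_greatest)
  \<comment> \<open>The balls of radius \<open>\<delta>\<close> about the points of \<open>A\<close>
    show that the infimum is over a nonempty set.\<close>
  have "finite ((\<lambda>a. (a, \<delta>)) ` A)" "\<forall>(x, r)\<in>(\<lambda>a. (a, \<delta>)) ` A. \<delta> \<le> r"
      "A \<subseteq> (\<Union>(x, r)\<in>(\<lambda>a. (a, \<delta>)) ` A. cball x r)"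
    using assms(1,2) by (auto intro: bexI)
  then show "{(\<Sum>(x, r)\<in>I. r powr s) | I.
            finite I \<and> (\<forall>(x, r)\<in>I. \<delta> \<le> r) \<and> A \<subseteq> (\<Union>(x, r)\<in>I. cball x r)} \<noteq> {}"
    by blast
qed (use assms(3) in blast)

lemma coarse_content_empty:
  assumes "0 < \<delta>"
  shows "coarse_content s \<delta> ({} :: 'a::metric_space set) = 0"
proof (rule antisym)
  show "coarse_content s \<delta> ({} :: 'a set) \<le> 0"
    using coarse_content_le[of "{}" \<delta> "{} :: 'a set" s] by simp
  show "0 \<le> coarse_content s \<delta> ({} :: 'a set)"
    using \<open>0 < \<delta>\<close> by (intro coarse_content_greatest) (auto intro!: sum_nonneg)
qed

lemma coarse_content_pos:
  assumes "finite A" "A \<noteq> {}" "0 < \<delta>" "0 < s"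
  shows "0 < coarse_content s \<delta> A"
proof -
  have "\<delta> powr s \<le> coarse_content s \<delta> A"
  proof (rule coarse_content_greatest[OF assms(1,3)])
    fix I assume I: "finite I" "\<forall>(x, r)\<in>I. \<delta> \<le> r" "A \<subseteq> (\<Union>(x, r)\<in>I. cball x r)"
    obtain x r where xr: "(x, r) \<in> I" using I(3) assms(2) by blast
    then have "\<delta> powr s \<le> r powr s" using I(2) assms by (intro powr_mono2) auto
    also have "\<dots> \<le> (\<Sum>(x, r)\<in>I. r powr s)"
      using member_le_sum[of "(x, r)" I "\<lambda>(x, r). r powr s"] xr I(1) by auto
    finally show "\<delta> powr s \<le> (\<Sum>(x, r)\<in>I. r powr s)" .
  qed
  then show ?thesis using assms(3) by (smt (verit) powr_gt_zero)
qed

lemma coarse_content_mono: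
  assumes "A \<subseteq> B" "finite B" "0 < \<delta>"
  shows "coarse_content s \<delta> A \<le> coarse_content s \<delta> B"
  using assms by (intro coarse_content_greatest coarse_content_le) auto

lemma coarse_content_Un_le:
  assumes "finite A" "finite B" "0 < \<delta>"
  shows "coarse_content s \<delta> (A \<union> B) \<le> coarse_content s \<delta> A + coarse_content s \<delta> B"
proof -
  let ?\<sigma> = "\<lambda>I. \<Sum>(x::'a, r)\<in>I. r powr s"
  have *: "coarse_content s \<delta> (A \<union> B) \<le> ?\<sigma> I + ?\<sigma> J"
    if "finite I" "\<forall>(x, r)\<in>I. \<delta> \<le> r" "A \<subseteq> (\<Union>(x, r)\<in>I. cball x r)"
       "finite J" "\<forall>(x, r)\<in>J. \<delta> \<le> r" "B \<subseteq> (\<Union>(x, r)\<in>J. cball x r)" for I J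
  proof -
    have "coarse_content s \<delta> (A \<union> B) \<le> ?\<sigma> (I \<union> J)"
      using that by (intro coarse_content_le) blast+
    also have "\<dots> \<le> ?\<sigma> I + ?\<sigma> J"
      using sum.union_inter[OF that(1,4), of "\<lambda>(x, r). r powr s"] sum_nonneg[of "I \<inter> J" "\<lambda>(x, r). r powr s"]
      by (auto simp: case_prod_beta)
    finally show ?thesis .
  qed
  \<comment> \<open>The two infima are taken in turn: over covers of \<open>B\<close> for a fixed
    \<open>I\<close>, then over \<open>I\<close>.\<close>
  have "coarse_content s \<delta> (A \<union> B) - ?\<sigma> I \<le> coarse_content s \<delta> B"
    if "finite I" "\<forall>(x, r)\<in>I. \<delta> \<le> r" "A \<subseteq> (\<Union>(x, r)\<in>I. cball x r)" for I
    using *[OF that] assms by (intro coarse_content_greatest) (auto simp: algebra_simps)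
  then have "coarse_content s \<delta> (A \<union> B) - coarse_content s \<delta> B \<le> coarse_content s \<delta> A"
    using assms by (intro coarse_content_greatest) (auto simp: algebra_simps)
  then show ?thesis by simp
qed

lemma coarse_content_cball_le:
  assumes "\<delta> \<le> r"
  shows "coarse_content s \<delta> (A \<inter> cball x r) \<le> r powr s"
  using coarse_content_le[of "{(x, r)}" \<delta> "A \<inter> cball x r" s] assms by auto

section \<open>Hoelder maps onto the cube\<close>

text \<open>The infimum of the cones \<open>\<phi> i + D (\<kappa> i) x\<close> is an extension with
  modulus \<open>D\<close>. Data are indexed through \<open>\<kappa>\<close>, which need not be
  injective: \<open>bound\<close> and \<open>refl\<close> force equal values at equal points.
  \<open>D\<close> serves both as a power of the distance on the line and as a multiple of a
  metric.\<close>

lemma mcshane_extension: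
  fixes D :: "'a \<Rightarrow> 'a \<Rightarrow> real" and \<kappa> :: "'i \<Rightarrow> 'a" and \<phi> :: "'i \<Rightarrow> real"
  assumes "I \<noteq> {}"
    and refl: "\<And>x. D x x = 0" and sym: "\<And>x y. D x y = D y x"
    and tri: "\<And>x y z. D x z \<le> D x y + D y z"
    and bound: "\<And>i j. i \<in> I \<Longrightarrow> j \<in> I \<Longrightarrow> \<bar>\<phi> i - \<phi> j\<bar> \<le> D (\<kappa> i) (\<kappa> j)"
  shows "\<exists>g. (\<forall>i\<in>I. g (\<kappa> i) = \<phi> i) \<and> (\<forall>x y. \<bar>g x - g y\<bar> \<le> D x y)"
proof -
  define g where "g x = (INF i\<in>I. \<phi> i + D (\<kappa> i) x)" for x
  obtain i0 where i0: "i0 \<in> I" using assms(1) by blast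
  have bdd: "bdd_below ((\<lambda>i. \<phi> i + D (\<kappa> i) x) ` I)" for x
  proof (rule bdd_belowI2[of _ "\<phi> i0 - D (\<kappa> i0) x"])
    fix i assume "i \<in> I"
    then show "\<phi> i0 - D (\<kappa> i0) x \<le> \<phi> i + D (\<kappa> i) x"
      using bound[OF i0 \<open>i \<in> I\<close>] tri[of "\<kappa> i0" "\<kappa> i" x] tri[of "\<kappa> i0" x "\<kappa> i"] sym[of x "\<kappa> i"]
      by linarith
  qed
  have le: "g x \<le> g y + D x y" for x y
  proof -
    have "g x - D x y \<le> g y"
      unfolding g_def
    proof (rule cINF_greatest[OF assms(1)])
      fix i assume "i \<in> I"
      then have "(INF i\<in>I. \<phi> i + D (\<kappa> i) x) \<le> \<phi> i + D (\<kappa> i) x" by (intro cINF_lower bdd)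
      then show "(INF i\<in>I. \<phi> i + D (\<kappa> i) x) - D x y \<le> \<phi> i + D (\<kappa> i) y"
        using tri[of "\<kappa> i" x y] sym[of x y] by linarith
    qed
    then show ?thesis by simp
  qed
  have "g (\<kappa> i) = \<phi> i" if i: "i \<in> I" for i
  proof (rule antisym)
    show "g (\<kappa> i) \<le> \<phi> i" unfolding g_def using cINF_lower[OF bdd i, of "\<kappa> i"] refl by simp
    show "\<phi> i \<le> g (\<kappa> i)" unfolding g_def
    proof (rule cINF_greatest[OF assms(1)])
      fix j assume "j \<in> I"
      then show "\<phi> i \<le> \<phi> j + D (\<kappa> j) (\<kappa> i)" using bound[OF i \<open>j \<in> I\<close>] sym[of "\<kappa> j" "\<kappa> i"] by linarith
    qed
  qed
  moreover have "\<bar>g x - g y\<bar> \<le> D x y" for x y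
    using le[of x y] le[of y x] sym[of x y] by linarith
  ultimately show ?thesis by blast
qed

text \<open>A fraction in [0, 1] is at most its \<open>q\<close>-th power, and the fractions of
  \<open>a\<close> and \<open>b\<close> in \<open>a + b\<close> sum to 1.\<close>

lemma powr_add_le:
  fixes a b q :: real
  assumes "0 \<le> a" "0 \<le> b" "0 < q" "q \<le> 1"
  shows "(a + b) powr q \<le> a powr q + b powr q"
proof (cases "a + b = 0")
  case False
  then have pos: "0 < a + b" using assms by linarith
  have frac: "x / (a + b) \<le> (x / (a + b)) powr q" if "0 \<le> x" "x \<le> a + b" for x
    using powr_mono'[of q 1 "x / (a + b)"] that pos assms by (auto simp: field_simps)
  have "1 = a / (a + b) + b / (a + b)" using pos by (simp add: add_divide_distrib[symmetric])
  also have "\<dots> \<le> (a / (a + b)) powr q + (b / (a + b)) powr q"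
    using assms by (intro add_mono frac) auto
  also have "\<dots> = (a powr q + b powr q) / (a + b) powr q"
    using pos assms by (simp add: powr_divide add_divide_distrib)
  finally show ?thesis using pos by (simp add: field_simps)
qed (use assms in auto)

lemma binary_expansion_exists:
  assumes "0 \<le> y" "y \<le> (1::real)"
  shows "\<exists>b. (\<forall>m. b m \<in> {0, 1}) \<and> (\<lambda>m. b m / 2 ^ Suc m) sums y"
proof -
  \<comment> \<open>Greedy digits: \<open>z m\<close> is the remainder after \<open>m\<close>
    digits, rescaled by \<open>2 ^ m\<close>. It stays in [0, 1]; for \<open>y = 1\<close> all
    digits are 1.\<close>
  define z where "z = rec_nat y (\<lambda>_ z. 2 * z - (if 1 / 2 \<le> z then 1 else 0))"
  define b where "b m = (if 1 / 2 \<le> z m then 1 else 0 :: real)" for m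
  have z: "z 0 = y" "z (Suc m) = 2 * z m - b m" for m by (simp_all add: z_def b_def)
  have z01: "0 \<le> z m \<and> z m \<le> 1" for m
    by (induction m) (use assms in \<open>auto simp: z b_def\<close>)
  have part: "(\<Sum>i<m. b i / 2 ^ Suc i) = y - z m / 2 ^ m" for m
    by (induction m) (simp_all add: z diff_divide_distrib)
  have "(\<lambda>m. z m / 2 ^ m) \<longlonglongrightarrow> 0"
  proof (rule tendsto_sandwich)
    show "\<forall>\<^sub>F m in sequentially. 0 \<le> z m / 2 ^ m" using z01 by simp
    show "\<forall>\<^sub>F m in sequentially. z m / 2 ^ m \<le> (1 / 2) ^ m"
      using z01 by (simp add: power_divide divide_right_mono)
    show "(\<lambda>m. (1 / 2) ^ m :: real) \<longlonglongrightarrow> 0" by (rule LIMSEQ_realpow_zero) auto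
  qed simp
  then have "(\<lambda>m. b m / 2 ^ Suc m) sums y"
    unfolding sums_def part using tendsto_diff[of "\<lambda>_. y" y sequentially "\<lambda>m. z m / 2 ^ m" 0] by simp
  then show ?thesis by (intro exI[of _ b]) (auto simp: b_def)
qed

text \<open>Used twice for digit series: to bound \<open>\<kappa> b - \<kappa> c\<close> from below
  by its first differing digit, and \<open>H j b - H j c\<close> from above by its common initial
  digits.\<close>

lemma abs_suminf_diff_tail_le:
  fixes a b c :: "nat \<Rightarrow> real"
  assumes a: "summable a" and "\<And>m. \<bar>b m\<bar> \<le> a m" "\<And>m. \<bar>c m\<bar> \<le> a m"
    and bc: "\<And>m. \<bar>b m - c m\<bar> \<le> a m"
  shows "\<bar>suminf b - suminf c - (\<Sum>m<n. b m - c m)\<bar> \<le> (\<Sum>m. a (m + n))"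
proof -
  have b: "summable b" by (rule summable_comparison_test'[OF a]) (simp add: assms(2))
  have c: "summable c" by (rule summable_comparison_test'[OF a]) (simp add: assms(3))
  have a': "summable (\<lambda>m. a (m + n))" using a by (rule summable_ignore_initial_segment)
  have d: "summable (\<lambda>m. \<bar>b (m + n) - c (m + n)\<bar>)"
    by (rule summable_comparison_test'[OF a']) (simp add: bc)
  have "suminf b - suminf c = (\<Sum>m. b m - c m)" using b c by (rule suminf_diff)
  also have "\<dots> = (\<Sum>m. b (m + n) - c (m + n)) + (\<Sum>m<n. b m - c m)"
    by (rule suminf_split_initial_segment) (intro summable_diff b c)
  finally have "\<bar>suminf b - suminf c - (\<Sum>m<n. b m - c m)\<bar> = \<bar>\<Sum>m. b (m + n) - c (m + n)\<bar>"
    by simp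
  also have "\<dots> \<le> (\<Sum>m. \<bar>b (m + n) - c (m + n)\<bar>)" using d by (rule summable_rabs)
  also have "\<dots> \<le> (\<Sum>m. a (m + n))" by (rule suminf_le[OF bc d a'])
  finally show ?thesis .
qed

text \<open>On the Cantor set of the sums \<open>\<Sum>m. b m * l^m\<close> with digits \<open>b m\<close> in \<open>{0, 1}\<close>, the digits are
  dealt out cyclically to the \<open>k\<close> coordinates as binary digits; \<open>l = 2\<^bsup>-p/k\<^esup> < 1/2\<close> makes the
  Cantor set separated and the exponent \<open>1/p\<close> exact.\<close>
lemma holder_map_onto_cube:
  assumes p: "real CARD('k::finite) < p"
  shows "\<exists>(h :: real \<Rightarrow> real ^ 'k) C M. 0 \<le> C \<and>
           (\<forall>u v. dist (h u) (h v) \<le> C * \<bar>u - v\<bar> powr (1 / p)) \<and> cbox 0 One \<subseteq> h ` {0..M}"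
proof -
  define k where "k = CARD('k)"
  have k: "0 < k" "1 \<le> real k" "real k < p" using p by (auto simp: k_def Suc_le_eq)
  define l :: real where "l = 2 powr (- p / real k)"
  have "2 powr (- p / real k) < 2 powr (-1 :: real)"
    using k by (intro powr_less_mono) (auto simp: field_simps)
  then have l: "0 < l" "l < 1 / 2" by (auto simp: l_def powr_minus)
  define B where "B = {b :: nat \<Rightarrow> real. \<forall>m. b m \<in> {0, 1}}"
  have B: "\<bar>b m\<bar> \<le> 1" "\<bar>b m - c m\<bar> \<le> 1" if "b \<in> B" "c \<in> B" for b c m
    using that by (auto simp: B_def; smt (verit))+
  define \<kappa> where "\<kappa> b = (\<Sum>m. b m * l ^ m)" for b :: "nat \<Rightarrow> real"
  obtain e :: "'k \<Rightarrow> nat" where e: "bij_betw e UNIV {..<k}"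
    using ex_bij_betw_finite_nat[of "UNIV :: 'k set"] by (auto simp: k_def atLeast0LessThan)
  have e_less: "e j < k" for j using e by (auto dest: bij_betwE)
  define H where "H j b = (\<Sum>m. b (k * m + e j) * (1 / 2) ^ Suc m)" for j and b :: "nat \<Rightarrow> real"
  \<comment> \<open>If \<open>i\<close> is the first differing digit, the term \<open>l ^ i\<close>
    outweighs the tail \<open>l ^ Suc i / (1 - l)\<close> by \<open>c0 * l ^ i\<close>, and
    \<open>c0 > 0\<close> because \<open>l < 1 / 2\<close>.\<close>
  define c0 where "c0 = (1 - 2 * l) / (1 - l)"
  have c0: "0 < c0" using l by (simp add: c0_def)
  define K where "K = 2 * (1 / c0) powr (1 / p)"
  have sum_l: "(\<lambda>m. l ^ m) sums (1 / (1 - l))" using l by (intro geometric_sums) auto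
  have sum_half: "(\<lambda>m. (1 / 2 :: real) ^ Suc m) sums 1" by (rule power_half_series)
  have holder: "\<bar>H j b - H j c\<bar> \<le> K * \<bar>\<kappa> b - \<kappa> c\<bar> powr (1 / p)" if bc: "b \<in> B" "c \<in> B" for j b c
  proof (cases "b = c")
    case False
    define i where "i = (LEAST i. b i \<noteq> c i)"
    have i: "b i \<noteq> c i" using False LeastI_ex[of "\<lambda>i. b i \<noteq> c i"] by (auto simp: i_def)
    have agree: "b m = c m" if "m < i" for m using not_less_Least[OF that[unfolded i_def]] by simp
    have "\<bar>\<kappa> b - \<kappa> c - (\<Sum>m<Suc i. b m * l ^ m - c m * l ^ m)\<bar> \<le> (\<Sum>m. l ^ (m + Suc i))"
      unfolding \<kappa>_def
    proof (rule abs_suminf_diff_tail_le)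
      show "summable ((^) l)" using sum_l by (rule sums_summable)
      show "\<bar>b m * l ^ m - c m * l ^ m\<bar> \<le> l ^ m" for m
        using B(2)[OF bc, of m] l by (simp add: left_diff_distrib[symmetric] abs_mult mult_left_le_one_le)
    qed (use B bc l in \<open>simp_all add: abs_mult mult_left_le_one_le\<close>)
    also have "(\<Sum>m. l ^ (m + Suc i)) = l ^ Suc i / (1 - l)"
      using sums_mult2[OF sum_l, of "l ^ Suc i"] by (simp add: power_add sums_iff mult_ac)
    also have "(\<Sum>m<Suc i. b m * l ^ m - c m * l ^ m) = (b i - c i) * l ^ i"
      using agree by (simp add: left_diff_distrib)
    finally have "\<bar>(b i - c i) * l ^ i\<bar> - l ^ Suc i / (1 - l) \<le> \<bar>\<kappa> b - \<kappa> c\<bar>" by linarith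
    moreover have "\<bar>(b i - c i) * l ^ i\<bar> = l ^ i"
      using i bc l by (auto simp: B_def abs_mult; smt (verit))
    moreover have "l ^ i - l ^ Suc i / (1 - l) = c0 * l ^ i"
      using l by (simp add: c0_def field_simps)
    ultimately have low: "c0 * l ^ i \<le> \<bar>\<kappa> b - \<kappa> c\<bar>" by simp
    \<comment> \<open>Agreement of the first \<open>i\<close> digits gives every coordinate at least
      \<open>n\<close> common binary digits.\<close>
    define n where "n = i div k"
    have "b (k * m + e j) = c (k * m + e j)" if "m < n" for m
    proof (rule agree)
      have "k * m + e j < k * m + k" using e_less by simp
      also have "\<dots> = k * Suc m" by simp
      also have "\<dots> \<le> k * n" using that by (intro mult_le_mono2) auto
      also have "\<dots> \<le> i" by (simp add: n_def)
      finally show "k * m + e j < i" .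
    qed
    then have zero: "(\<Sum>m<n. b (k * m + e j) * (1 / 2) ^ Suc m - c (k * m + e j) * (1 / 2) ^ Suc m) = 0"
      by simp
    have "\<bar>H j b - H j c - (\<Sum>m<n. b (k * m + e j) * (1 / 2) ^ Suc m - c (k * m + e j) * (1 / 2) ^ Suc m)\<bar>
            \<le> (\<Sum>m. (1 / 2) ^ Suc (m + n))"
      unfolding H_def
    proof (rule abs_suminf_diff_tail_le[where a = "\<lambda>m. (1 / 2) ^ Suc m"])
      show "summable (\<lambda>m. (1 / 2 :: real) ^ Suc m)" using sum_half by (rule sums_summable)
      show "\<bar>b (k * m + e j) * (1 / 2) ^ Suc m - c (k * m + e j) * (1 / 2) ^ Suc m\<bar> \<le> (1 / 2) ^ Suc m" for m
        using B(2)[OF bc, of "k * m + e j"]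
        by (simp only: left_diff_distrib[symmetric] abs_mult) (simp add: mult_left_le_one_le)
      show "\<bar>b (k * m + e j) * (1 / 2) ^ Suc m\<bar> \<le> (1 / 2) ^ Suc m"
           "\<bar>c (k * m + e j) * (1 / 2) ^ Suc m\<bar> \<le> (1 / 2) ^ Suc m" for m
        using B(1)[OF bc(1) bc(1), of "k * m + e j"] B(1)[OF bc(2) bc(2), of "k * m + e j"]
        by (simp_all only: abs_mult) (simp_all add: mult_left_le_one_le)
    qed
    also have "(\<Sum>m. (1 / 2 :: real) ^ Suc (m + n)) = (1 / 2) ^ n"
      using sums_mult2[OF sum_half, of "(1 / 2) ^ n"] by (simp add: power_add sums_iff)
    finally have "\<bar>H j b - H j c\<bar> \<le> (1 / 2) ^ n" unfolding zero by simp
    also have "(1 / 2 :: real) ^ n = 2 powr (- real n)"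
      by (simp add: powr_minus powr_realpow power_divide inverse_eq_divide)
    \<comment> \<open>Rounding \<open>i / k\<close> down to \<open>n\<close> costs at most 1 in the
      exponent; hence the factor 2 in \<open>K\<close>.\<close>
    also have "\<dots> \<le> 2 powr (1 - real i / real k)"
    proof (rule powr_mono)
      have "real i \<le> real k * (real n + 1)"
      proof -
        have "i \<le> k * (n + 1)" using k(1) dividend_less_times_div[of k i] by (simp add: n_def)
        then have "real i \<le> real (k * (n + 1))" by (rule of_nat_mono)
        then show ?thesis by (simp add: distrib_left)
      qed
      then show "- real n \<le> 1 - real i / real k" using k(1) by (simp add: field_simps)
    qed simp
    also have "\<dots> = 2 * (l ^ i) powr (1 / p)"
    proof -
      have "(l ^ i) powr (1 / p) = (l powr real i) powr (1 / p)" using l by (simp add: powr_realpow)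
      also have "\<dots> = 2 powr (- (p / real k) * real i * (1 / p))" by (simp add: l_def powr_powr)
      also have "- (p / real k) * real i * (1 / p) = - (real i / real k)" using k by simp
      finally show ?thesis by (simp add: powr_diff powr_minus field_simps)
    qed
    also have "\<dots> \<le> 2 * (\<bar>\<kappa> b - \<kappa> c\<bar> * (1 / c0)) powr (1 / p)"
      using low c0 l k by (intro mult_left_mono powr_mono2) (auto simp: field_simps)
    also have "\<dots> = K * \<bar>\<kappa> b - \<kappa> c\<bar> powr (1 / p)"
      using c0 by (subst powr_mult) (simp_all add: K_def)
    finally show ?thesis .
  qed (use c0 in \<open>simp add: K_def\<close>)
  \<comment> \<open>As \<open>1 / p <= 1\<close>, the function
    \<open>K * \<bar>u - v\<bar> powr (1 / p)\<close> obeys the triangle inequality, so each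
    coordinate extends from the Cantor set to the line with the same exponent and constant.\<close>
  have ext: "\<exists>g. (\<forall>b\<in>B. g (\<kappa> b) = H j b) \<and> (\<forall>u v. \<bar>g u - g v\<bar> \<le> K * \<bar>u - v\<bar> powr (1 / p))" for j
  proof (rule mcshane_extension)
    show "B \<noteq> {}" by (auto simp: B_def)
    show "K * \<bar>u - w\<bar> powr (1 / p) \<le> K * \<bar>u - v\<bar> powr (1 / p) + K * \<bar>v - w\<bar> powr (1 / p)" for u v w
    proof -
      have "\<bar>u - w\<bar> powr (1 / p) \<le> (\<bar>u - v\<bar> + \<bar>v - w\<bar>) powr (1 / p)"
        using k by (intro powr_mono2) auto
      also have "\<dots> \<le> \<bar>u - v\<bar> powr (1 / p) + \<bar>v - w\<bar> powr (1 / p)"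
        using k by (intro powr_add_le) auto
      finally show ?thesis using c0 by (simp add: K_def distrib_left[symmetric])
    qed
  qed (use holder in \<open>auto simp: abs_minus_commute\<close>)
  then obtain g where g: "\<And>j b. b \<in> B \<Longrightarrow> g j (\<kappa> b) = H j b"
      "\<And>j u v. \<bar>g j u - g j v\<bar> \<le> K * \<bar>u - v\<bar> powr (1 / p)"
    by metis
  define h :: "real \<Rightarrow> real ^ 'k" where "h u = (\<chi> j. g j u)" for u
  have "dist (h u) (h v) \<le> real k * K * \<bar>u - v\<bar> powr (1 / p)" for u v
  proof -
    have "dist (h u) (h v) \<le> (\<Sum>j\<in>UNIV. \<bar>(h u - h v) $ j\<bar>)"
      unfolding dist_norm by (rule norm_le_l1_cart)
    also have "\<dots> \<le> (\<Sum>j\<in>(UNIV :: 'k set). K * \<bar>u - v\<bar> powr (1 / p))"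
      using g(2) by (intro sum_mono) (simp add: h_def)
    finally show ?thesis by (simp add: k_def)
  qed
  moreover have "cbox 0 One \<subseteq> h ` {0..1 / (1 - l)}"
  proof
    fix y :: "real ^ 'k" assume "y \<in> cbox 0 One"
    then have box: "0 \<bullet> i \<le> y \<bullet> i \<and> y \<bullet> i \<le> One \<bullet> i" if "i \<in> Basis" for i
      using that by (simp only: mem_box)
    have "0 \<le> y $ j \<and> y $ j \<le> 1" for j
    proof -
      have j: "axis j 1 \<in> (Basis :: (real ^ 'k) set)" by (simp add: axis_in_Basis_iff)
      show ?thesis using box[OF j] unfolding inner_sum_Basis[OF j] by (simp add: inner_axis)
    qed
    then have "\<exists>b. (\<forall>m. b m \<in> {0, 1}) \<and> (\<lambda>m. b m / 2 ^ Suc m) sums (y $ j)" for j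
      by (intro binary_expansion_exists) auto
    then obtain \<beta> where \<beta>: "\<And>j m. \<beta> j m \<in> {0, 1}" "\<And>j. (\<lambda>m. \<beta> j m / 2 ^ Suc m) sums (y $ j)"
      by metis
    \<comment> \<open>Interleaving the binary digits of the coordinates inverts the dealing out in
      \<open>H\<close>.\<close>
    define b where "b m = \<beta> (inv_into UNIV e (m mod k)) (m div k)" for m
    have bB: "b \<in> B" using \<beta>(1) by (auto simp: B_def b_def)
    have "b (k * m + e j) = \<beta> j m" for m j
      using e_less[of j] e by (simp add: b_def bij_betw_def)
    then have "H j b = y $ j" for j
      using \<beta>(2)[of j] by (simp add: H_def sums_iff power_divide)
    then have "h (\<kappa> b) = y" by (simp add: h_def vec_eq_iff g(1)[OF bB])
    moreover have "\<kappa> b \<in> {0..1 / (1 - l)}"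
    proof -
      have le: "0 \<le> b m * l ^ m" "b m * l ^ m \<le> l ^ m" for m
      proof -
        have "b m = 0 \<or> b m = 1" using bB by (simp add: B_def)
        then show "0 \<le> b m * l ^ m" "b m * l ^ m \<le> l ^ m" using l by auto
      qed
      have "summable (\<lambda>m. b m * l ^ m)"
        by (rule summable_comparison_test'[OF sums_summable[OF sum_l]]) (use le in simp)
      then show ?thesis
        unfolding \<kappa>_def using le sum_l suminf_le[of "\<lambda>m. b m * l ^ m" "\<lambda>m. l ^ m"]
        by (auto simp: sums_iff intro!: suminf_nonneg)
    qed
    ultimately show "y \<in> h ` {0..1 / (1 - l)}" by blast
  qed
  moreover have "0 \<le> real k * K" by (simp add: K_def)
  ultimately show ?thesis by blast
qed

section \<open>Limits of Lipschitz maps\<close>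

lemma compact_countable_dense_subset:
  fixes X :: "'a::metric_space set"
  assumes "compact X"
  shows "\<exists>R\<subseteq>X. countable R \<and> (\<forall>x\<in>X. \<forall>e>0. \<exists>y\<in>R. dist x y < e)"
proof -
  have "\<forall>n. \<exists>N. finite N \<and> N \<subseteq> X \<and> X \<subseteq> (\<Union>x\<in>N. ball x (1 / Suc n))"
    using seq_compact_imp_totally_bounded[OF compact_imp_seq_compact[OF assms]] by simp
  then obtain N where N: "\<And>n. finite (N n)" "\<And>n. N n \<subseteq> X" "\<And>n. X \<subseteq> (\<Union>x\<in>N n. ball x (1 / Suc n))"
    by metis
  have "\<exists>y\<in>(\<Union>n. N n). dist x y < e" if "x \<in> X" "0 < e" for x e
  proof -
    obtain n where n: "1 / Suc n < e" using nat_approx_posE[OF \<open>0 < e\<close>] by blast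
    obtain y where "y \<in> N n" "dist y x < 1 / Suc n" using N(3)[of n] \<open>x \<in> X\<close> by auto
    then show ?thesis using n by (intro bexI[of _ y]) (auto simp: dist_commute)
  qed
  moreover have "countable (\<Union>n. N n)" using N(1) countable_finite by blast
  moreover have "(\<Union>n. N n) \<subseteq> X" using N(2) by blast
  ultimately show ?thesis by blast
qed

text \<open>An Arzela-Ascoli argument: a subsequence converges on a countable dense set, and the
  common Lipschitz constant spreads this to all of \<open>X\<close>. The limit is onto because
  approximate preimages of a point cluster in the compact \<open>X\<close>.\<close>

lemma lipschitz_onto_limit:
  fixes X :: "'a::metric_space set" and f :: "nat \<Rightarrow> 'a \<Rightarrow> 'b::euclidean_space"
  assumes "compact X" "compact K"
    and lip: "\<And>n. L-lipschitz_on X (f n)"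
    and into: "\<And>n. f n ` X \<subseteq> K"
    and dense: "\<And>n y. y \<in> K \<Longrightarrow> \<exists>x\<in>X. dist (f n x) y \<le> \<epsilon> n"
    and \<epsilon>: "\<epsilon> \<longlonglongrightarrow> 0"
  shows "\<exists>g. L-lipschitz_on X g \<and> g ` X = K"
proof -
  obtain R where R: "R \<subseteq> X" "countable R" "\<And>x e. x \<in> X \<Longrightarrow> 0 < e \<Longrightarrow> \<exists>y\<in>R. dist x y < e"
    using compact_countable_dense_subset[OF assms(1)] by metis
  obtain M where M: "\<And>y. y \<in> K \<Longrightarrow> norm y \<le> M"
    using compact_imp_bounded[OF assms(2)] by (auto simp: bounded_iff)
  obtain k where k: "strict_mono (k :: nat \<Rightarrow> nat)"
      "\<And>x. x \<in> R \<Longrightarrow> \<exists>l. (\<lambda>n. f (k n) x) \<longlonglongrightarrow> l"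
  proof (rule function_convergent_subsequence[OF R(2), of f M])
    show "norm (f n x) \<le> M" if "x \<in> R" for n x using that R(1) into by (intro M) blast
  qed (use that in blast)
  have L: "0 \<le> L" using lip lipschitz_on_nonneg by blast
  have lipD: "dist (f n x) (f n y) \<le> L * dist x y" if "x \<in> X" "y \<in> X" for n x y
    using lipschitz_onD[OF lip that] .
  have "convergent (\<lambda>n. f (k n) x)" if x: "x \<in> X" for x
  proof (rule Cauchy_convergent, rule metric_CauchyI)
    fix e :: real assume e: "0 < e"
    then have "0 < e / (3 * (L + 1))" using L by simp
    then obtain y where y: "y \<in> R" "dist x y < e / (3 * (L + 1))" using R(3)[OF x] by blast
    have "L * dist x y \<le> (L + 1) * dist x y" by (intro mult_right_mono) auto
    also have "\<dots> < e / 3" using y(2) L by (simp add: field_simps)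
    finally have small: "L * dist x y < e / 3" .
    have "Cauchy (\<lambda>n. f (k n) y)" using k(2)[OF y(1)] LIMSEQ_imp_Cauchy by blast
    then obtain m where m: "\<And>i j. i \<ge> m \<Longrightarrow> j \<ge> m \<Longrightarrow> dist (f (k i) y) (f (k j) y) < e / 3"
      using metric_CauchyD[of "\<lambda>n. f (k n) y" "e / 3"] e by auto
    have "dist (f (k i) x) (f (k j) x) < e" if "i \<ge> m" "j \<ge> m" for i j
    proof -
      have "dist (f n x) (f n y) < e / 3" for n 
        using lipD[OF x subsetD[OF R(1) y(1)], of n] small by linarith
      from this[of "k i"] this[of "k j"] show ?thesis
        using m[OF that] dist_triangle[of "f (k i) x" "f (k j) x" "f (k i) y"]
          dist_triangle[of "f (k i) y" "f (k j) x" "f (k j) y"]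
        by (simp add: dist_commute)
    qed
    then show "\<exists>m. \<forall>i\<ge>m. \<forall>j\<ge>m. dist (f (k i) x) (f (k j) x) < e" by blast
  qed
  then have lim: "(\<lambda>n. f (k n) x) \<longlonglongrightarrow> lim (\<lambda>n. f (k n) x)" if "x \<in> X" for x
    using that by (simp add: convergent_LIMSEQ_iff)
  define g where "g x = lim (\<lambda>n. f (k n) x)" for x
  have g: "(\<lambda>n. f (k n) x) \<longlonglongrightarrow> g x" if "x \<in> X" for x using lim that by (simp add: g_def)
  have "L-lipschitz_on X g"
  proof (rule lipschitz_onI[OF _ L])
    fix x y assume xy: "x \<in> X" "y \<in> X"
    show "dist (g x) (g y) \<le> L * dist x y"
      using tendsto_dist[OF g[OF xy(1)] g[OF xy(2)]] lipD[OF xy]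
      by (intro LIMSEQ_le_const2) auto
  qed
  moreover have "g x \<in> K" if "x \<in> X" for x
    using closed_sequentially[OF compact_imp_closed[OF assms(2)], of "\<lambda>n. f (k n) x" "g x"] g into that by blast
  moreover have "y \<in> g ` X" if y: "y \<in> K" for y
  proof -
    have "\<forall>n. \<exists>x\<in>X. dist (f (k n) x) y \<le> \<epsilon> (k n)" using dense y by blast
    then obtain x where x: "\<And>n. x n \<in> X" "\<And>n. dist (f (k n) (x n)) y \<le> \<epsilon> (k n)" by metis
    obtain z r where z: "z \<in> X" "strict_mono (r :: nat \<Rightarrow> nat)" "(x \<circ> r) \<longlonglongrightarrow> z"
      using seq_compactE[OF compact_imp_seq_compact[OF assms(1)], of x] x(1) by blast
    have kr: "strict_mono (k \<circ> r)" using k(1) z(2) by (rule strict_mono_o)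
    have "(\<lambda>n. dist z ((x \<circ> r) n)) \<longlonglongrightarrow> dist z z"
      by (intro tendsto_dist tendsto_const z(3))
    then have "(\<lambda>n. L * dist z (x (r n))) \<longlonglongrightarrow> 0"
      using tendsto_mult_left[of _ _ _ L] by fastforce
    from tendsto_add[OF this LIMSEQ_subseq_LIMSEQ[OF \<epsilon> kr]]
    have upper: "(\<lambda>n. L * dist z (x (r n)) + \<epsilon> (k (r n))) \<longlonglongrightarrow> 0"
      by (simp add: o_def)
    \<comment> \<open>Replacing the moving approximate preimages by their limit \<open>z\<close>
      costs only the Lipschitz term.\<close>
    have "dist (f (k (r n)) z) y \<le> L * dist z (x (r n)) + \<epsilon> (k (r n))" for n
      using dist_triangle[of "f (k (r n)) z" y "f (k (r n)) (x (r n))"]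
        lipD[OF z(1) x(1), of "k (r n)" "r n"] x(2)[of "r n"] by linarith
    then have "(\<lambda>n. dist (f (k (r n)) z) y) \<longlonglongrightarrow> 0"
      by (intro tendsto_sandwich[OF _ _ tendsto_const upper]) (auto intro: always_eventually)
    then have "(\<lambda>n. f (k (r n)) z) \<longlonglongrightarrow> y" by (subst tendsto_dist_iff)
    moreover have "(\<lambda>n. f (k (r n)) z) \<longlonglongrightarrow> g z"
      using LIMSEQ_subseq_LIMSEQ[OF g[OF z(1)] z(2)] by (simp add: o_def)
    ultimately have "y = g z" by (rule LIMSEQ_unique)
    then show ?thesis using z(1) by blast
  qed
  ultimately show ?thesis by blast
qed

text \<open>Each coordinate is extended separately; bounding the norm by the sum of the coordinates
  costs the factor \<open>CARD('k)\<close>.\<close>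

lemma lipschitz_extension_cart:
  fixes f :: "'a::metric_space \<Rightarrow> real ^ 'k"
  assumes "F \<noteq> {}" "L-lipschitz_on F f"
  shows "\<exists>g. (\<forall>x\<in>F. g x = f x) \<and> (real CARD('k) * L)-lipschitz_on UNIV g"
proof -
  have L: "0 \<le> L" using assms(2) by (rule lipschitz_on_nonneg)
  have "\<exists>g. (\<forall>x\<in>F. g x = f x $ j) \<and> (\<forall>x y. \<bar>g x - g y\<bar> \<le> L * dist x y)" for j
  proof (rule mcshane_extension[OF assms(1)])
    show "L * dist x z \<le> L * dist x y + L * dist y z" for x y z :: 'a
      using L dist_triangle[of x z y] by (simp add: distrib_left[symmetric] mult_left_mono)
    show "\<bar>f x $ j - f y $ j\<bar> \<le> L * dist x y" if "x \<in> F" "y \<in> F" for x y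
      using lipschitz_onD[OF assms(2) that] component_le_norm_cart[of "f x - f y" j]
      by (simp add: dist_norm)
  qed (auto simp: dist_commute)
  then obtain g where g: "\<And>j x. x \<in> F \<Longrightarrow> g j x = f x $ j"
      "\<And>j x y. \<bar>g j x - g j y\<bar> \<le> L * dist x y"
    by metis
  define G :: "'a \<Rightarrow> real ^ 'k" where "G x = (\<chi> j. g j x)" for x
  have "dist (G x) (G y) \<le> real CARD('k) * L * dist x y" for x y
  proof -
    have "dist (G x) (G y) \<le> (\<Sum>j\<in>UNIV. \<bar>(G x - G y) $ j\<bar>)"
      unfolding dist_norm by (rule norm_le_l1_cart)
    also have "\<dots> \<le> (\<Sum>j\<in>(UNIV :: 'k set). L * dist x y)"
      using g(2) by (intro sum_mono) (simp add: G_def)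
    finally show ?thesis by simp
  qed
  then have "(real CARD('k) * L)-lipschitz_on UNIV G" using L by (intro lipschitz_onI) auto
  moreover have "G x = f x" if "x \<in> F" for x using that by (simp add: G_def g(1) vec_eq_iff)
  ultimately show ?thesis by blast
qed

section \<open>From finite nets to the compact space and the cube\<close>

lemma compact_segment_map_on:
  fixes X :: "'a::metric_space set"
  assumes "compact X" "0 < s" "hausdorff_measure s X \<noteq> 0" "0 < t"
    and p: "p = s * (1 - 1 / real t)" "0 < p"
  shows "\<exists>v>0. \<forall>\<epsilon>>0. segment_map_on ((4 * real t) powr p) p \<epsilon> X v"
proof -
  obtain \<kappa> where \<kappa>: "0 < \<kappa>"
      "\<And>I. finite I \<Longrightarrow> \<forall>(x, r)\<in>I. 0 < r \<Longrightarrow> X \<subseteq> (\<Union>(x, r)\<in>I. cball x r) \<Longrightarrow>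
         \<kappa> \<le> (\<Sum>(x, r)\<in>I. r powr s)"
    using ball_cover_sum_bounded_below[OF assms(2,3)] by metis
  \<comment> \<open>This bounds from below the value obtained at scale \<open>r = 1\<close> with
    \<open>W = 1\<close>, independently of the net.\<close>
  define v where "v = min (2 powr p) (\<kappa> / 2 powr s)"
  have "segment_map_on ((4 * real t) powr p) p \<epsilon> X v" if \<epsilon>: "0 < \<epsilon>" for \<epsilon>
  proof -
    have "(\<lambda>n. (2 * (1 / 2) ^ n) powr p) \<longlonglongrightarrow> (2 * 0) powr p"
      using p(2) by (intro tendsto_powr' tendsto_mult tendsto_const LIMSEQ_realpow_zero) auto
    then have "(\<lambda>n. (2 * (1 / 2) ^ n) powr p) \<longlonglongrightarrow> 0" by simp
    then have "\<forall>\<^sub>F n in sequentially. (2 * (1 / 2) ^ n) powr p < \<epsilon>"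
      using \<epsilon> by (rule order_tendstoD)
    then obtain n where n: "(2 * (1 / 2) ^ n) powr p < \<epsilon>" by (auto simp: eventually_sequentially)
    define \<delta> :: real where "\<delta> = (1 / 2) ^ n"
    have \<delta>: "0 < \<delta>" by (simp add: \<delta>_def)
    obtain N where N: "finite N" "N \<subseteq> X" "X \<subseteq> (\<Union>x\<in>N. ball x \<delta>)"
      using seq_compact_imp_totally_bounded[OF compact_imp_seq_compact[OF assms(1)]] \<delta> by metis
    let ?w = "coarse_content s \<delta> :: 'a set \<Rightarrow> real"
    have fin: "finite A" if "A \<subseteq> N" for A using N(1) that by (rule rev_finite_subset)
    have "\<kappa> / 2 powr s \<le> ?w N"
    proof (rule coarse_content_greatest[OF N(1) \<delta>])
      fix I assume I: "finite I" "\<forall>(x, r)\<in>I. \<delta> \<le> r" "N \<subseteq> (\<Union>(x, r)\<in>I. cball x r)"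
      \<comment> \<open>Doubling the radii turns a cover of the net into a cover of
        \<open>X\<close>, because no radius is below the mesh \<open>\<delta>\<close>.\<close>
      define J where "J = (\<lambda>(x, r). (x, 2 * r)) ` I"
      have "\<kappa> \<le> (\<Sum>(x, r)\<in>J. r powr s)"
      proof (rule \<kappa>(2))
        show "finite J" using I(1) by (simp add: J_def)
        show "\<forall>(x, r)\<in>J. 0 < r" using I(2) \<delta> by (fastforce simp: J_def)
        show "X \<subseteq> (\<Union>(x, r)\<in>J. cball x r)"
        proof
          fix y assume "y \<in> X"
          then obtain a where a: "a \<in> N" "dist a y < \<delta>" using N(3) by auto
          then obtain x r where xr: "(x, r) \<in> I" "dist x a \<le> r" using I(3) by auto
          then have "\<delta> \<le> r" using I(2) by auto
          then have "dist x y \<le> 2 * r" using xr(2) a(2) dist_triangle[of x y a] by linarith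
          moreover have "(x, 2 * r) \<in> J" using xr(1) by (force simp: J_def)
          ultimately show "y \<in> (\<Union>(x, r)\<in>J. cball x r)" by force
        qed
      qed
      also have "\<dots> = (\<Sum>(x, r)\<in>I. (2 * r) powr s)"
        unfolding J_def by (subst sum.reindex) (auto simp: inj_on_def case_prod_beta)
      also have "\<dots> = (\<Sum>(x, r)\<in>I. r powr s) * 2 powr s"
        unfolding sum_distrib_right using I(2) \<delta> by (intro sum.cong) (auto simp: powr_mult)
      finally show "\<kappa> / 2 powr s \<le> (\<Sum>(x, r)\<in>I. r powr s)" by (simp add: divide_le_eq)
    qed
    moreover have "segment_map_on ((4 * real t) powr p) p ((2 * \<delta>) powr p) N
        (min ((2 * 1) powr p) (?w N / 1 powr (1 / real t)))"
    proof (rule segment_map_on_finite[OF N(1) \<delta> assms(4,2) _ _ _ _ _ p(1), where m = n and w = ?w])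
      show "?w {} = 0" using \<delta> by (rule coarse_content_empty)
      show "0 < ?w A" if "A \<subseteq> N" "A \<noteq> {}" for A
        using that(2) by (rule coarse_content_pos[OF fin[OF that(1)] _ \<delta> assms(2)])
      show "?w A \<le> ?w B" if "A \<subseteq> B" "B \<subseteq> N" for A B
        using that(1) fin[OF that(2)] \<delta> by (rule coarse_content_mono)
      show "?w (A \<union> B) \<le> ?w A + ?w B" if "A \<subseteq> N" "B \<subseteq> N" for A B
        using fin[OF that(1)] fin[OF that(2)] \<delta> by (rule coarse_content_Un_le)
      show "?w (N \<inter> cball x r) \<le> r powr s" if "\<delta> \<le> r" for x r
        using that by (rule coarse_content_cball_le)
      have "\<delta> \<le> 1" by (simp add: \<delta>_def power_le_one)
      then show "?w (N \<inter> cball x 1) \<le> 1" for x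
        using coarse_content_cball_le[of \<delta> 1 s N x] by simp
      show "1 = 2 ^ n * \<delta>" by (simp add: \<delta>_def power_mult_distrib[symmetric])
    qed auto
    ultimately show ?thesis
      using n N(2) by (elim segment_map_on_mono) (auto simp: v_def \<delta>_def)
  qed
  moreover have "0 < v" using \<kappa>(1) by (simp add: v_def)
  ultimately show ?thesis by blast
qed

theorem theorem1p1:
  fixes X :: "'a::metric_space set"
  assumes "compact X"
    and "hausdorff_dim X > ereal (real CARD('k::finite))"
  shows "\<exists>(f :: 'a \<Rightarrow> real ^ 'k) C. C-lipschitz_on X f \<and> f ` X = cbox 0 One"
proof -
  define k where "k = real CARD('k)"
  have k: "0 < k" by (simp add: k_def)
  obtain s where s: "k < s" "ereal s < hausdorff_dim X"
    using ereal_dense2[OF assms(2)] by (auto simp: k_def)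
  have meas: "hausdorff_measure s X \<noteq> 0"
  proof
    assume "hausdorff_measure s X = 0"
    then have "hausdorff_dim X \<le> ereal s"
      unfolding hausdorff_dim_def using s(1) k by (intro Inf_lower) auto
    then show False using s(2) by simp
  qed
  \<comment> \<open>The condition on \<open>t\<close> is \<open>s * (1 - 1 / t) > k\<close> solved
    for \<open>t\<close>.\<close>
  obtain t :: nat where t: "s / (s - k) < real t" using reals_Archimedean2 by blast
  then have "0 < real t" using s(1) k by (smt (verit) divide_pos_pos)
  then have t0: "0 < t" by simp
  define p where "p = s * (1 - 1 / real t)"
  have p: "k < p" using t t0 s(1) by (simp add: p_def field_simps)
  obtain h :: "real \<Rightarrow> real ^ 'k" and H M where h: "0 \<le> H"
      "\<And>u v. dist (h u) (h v) \<le> H * \<bar>u - v\<bar> powr (1 / p)" "cbox 0 One \<subseteq> h ` {0..M}"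
    using holder_map_onto_cube[where 'k = 'k, of p] p unfolding k_def by metis
  define C where "C = (4 * real t) powr p"
  obtain v where v: "0 < v" "\<And>\<epsilon>. 0 < \<epsilon> \<Longrightarrow> segment_map_on C p \<epsilon> X v"
    using compact_segment_map_on[OF assms(1) _ meas t0 p_def] s(1) k p unfolding C_def by auto
  \<comment> \<open>The rescaling stretches the segment of length \<open>v\<close> beyond
    \<open>M\<close>, so that it reaches every parameter used by \<open>h\<close>.\<close>
  define a where "a = (\<bar>M\<bar> + 1) / v"
  have a: "0 < a" using v(1) by (simp add: a_def)
  define L where "L = H * (a * C) powr (1 / p)"
  have approx: "\<exists>f :: 'a \<Rightarrow> real ^ 'k. (k * L)-lipschitz_on X f \<and> f ` X \<subseteq> cbox 0 One \<and>
      (\<forall>y\<in>cbox 0 One. \<exists>x\<in>X. dist (f x) y \<le> \<eta>)" if \<eta>: "0 < \<eta>" for \<eta>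
  proof -
    \<comment> \<open>Chosen so that rescaling by \<open>a\<close> and applying \<open>h\<close>
      leaves an error of at most \<open>H * (\<eta> / (H + 1))\<close>; the \<open>+ 1\<close>
      allows for \<open>H = 0\<close>.\<close>
    define \<epsilon> where "\<epsilon> = (\<eta> / (H + 1)) powr p / a"
    have "0 < \<epsilon>" using \<eta> h(1) a by (simp add: \<epsilon>_def)
    then obtain F g where F: "F \<subseteq> X"
        "\<And>x y. x \<in> F \<Longrightarrow> y \<in> F \<Longrightarrow> \<bar>g x - g y\<bar> \<le> C * dist x y powr p"
        "\<And>u. u \<in> {0..<v} \<Longrightarrow> \<exists>x\<in>F. \<bar>g x - u\<bar> \<le> \<epsilon>"
      using v(2) unfolding segment_map_on_def by metis
    have "F \<noteq> {}" using F(3)[of 0] v(1) by auto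
    moreover have "L-lipschitz_on F (\<lambda>x. h (a * g x))"
    proof (rule lipschitz_onI)
      fix x y assume xy: "x \<in> F" "y \<in> F"
      have "dist (h (a * g x)) (h (a * g y)) \<le> H * \<bar>a * g x - a * g y\<bar> powr (1 / p)" by (rule h(2))
      also have "\<bar>a * g x - a * g y\<bar> = a * \<bar>g x - g y\<bar>"
        using a by (simp add: right_diff_distrib[symmetric] abs_mult)
      also have "H * (a * \<bar>g x - g y\<bar>) powr (1 / p) \<le> H * (a * C * dist x y powr p) powr (1 / p)"
        using F(2)[OF xy] a h(1) p k by (intro mult_left_mono powr_mono2) (auto simp: mult.assoc)
      also have "\<dots> = L * (dist x y powr p) powr (1 / p)"
        using a by (subst powr_mult) (auto simp: L_def C_def)
      \<comment> \<open>The exponents \<open>p\<close> and \<open>1 / p\<close> cancel, so the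
        composite is Lipschitz with a constant independent of \<open>\<eta>\<close>.\<close>
      also have "\<dots> = L * dist x y" using p k by (simp add: powr_powr)
      finally show "dist (h (a * g x)) (h (a * g y)) \<le> L * dist x y" .
    qed (use h(1) in \<open>simp add: L_def\<close>)
    ultimately obtain f :: "'a \<Rightarrow> real ^ 'k" where f: "\<And>x. x \<in> F \<Longrightarrow> f x = h (a * g x)" "(k * L)-lipschitz_on UNIV f"
      using lipschitz_extension_cart unfolding k_def by metis
    \<comment> \<open>The extension may leave the cube; clamping is 1-Lipschitz and fixes the target
      points in the cube.\<close>
    let ?f = "\<lambda>x. clamp 0 One (f x)"
    have "(k * L)-lipschitz_on X ?f"
    proof (rule lipschitz_onI)
      show "dist (?f x) (?f y) \<le> k * L * dist x y" for x y
        using dist_clamps_le_dist_args[of 0 One "f x" "f y"] lipschitz_onD[OF f(2), of x y] by simp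
      show "0 \<le> k * L" using f(2) by (rule lipschitz_on_nonneg)
    qed
    moreover have "?f ` X \<subseteq> cbox 0 One" by (auto intro!: clamp_in_interval)
    moreover have "\<exists>x\<in>X. dist (?f x) y \<le> \<eta>" if y: "y \<in> cbox 0 One" for y
    proof -
      obtain u where u: "0 \<le> u" "u \<le> M" "y = h u" using subsetD[OF h(3) y] by auto
      have "u < a * v" using u(1,2) v(1) by (simp add: a_def)
      then have "u / a < v" using a by (simp add: field_simps)
      then obtain x where x: "x \<in> F" "\<bar>g x - u / a\<bar> \<le> \<epsilon>" using F(3)[of "u / a"] u(1) a by auto
      have "\<bar>a * g x - u\<bar> = a * \<bar>g x - u / a\<bar>" using a by (simp add: abs_mult_pos' right_diff_distrib)
      also have "\<dots> \<le> (\<eta> / (H + 1)) powr p" using x(2) a by (simp add: \<epsilon>_def field_simps)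
      finally have close: "\<bar>a * g x - u\<bar> \<le> (\<eta> / (H + 1)) powr p" .
      have "dist (?f x) y = dist (?f x) (clamp 0 One y)" using y by simp
      also have "\<dots> \<le> dist (f x) y" by (rule dist_clamps_le_dist_args)
      also have "\<dots> \<le> H * \<bar>a * g x - u\<bar> powr (1 / p)" unfolding f(1)[OF x(1)] u(3) by (rule h(2))
      also have "\<dots> \<le> H * ((\<eta> / (H + 1)) powr p) powr (1 / p)"
        using close h(1) p k by (intro mult_left_mono powr_mono2) auto
      also have "\<dots> = H * (\<eta> / (H + 1))" using p k \<eta> h(1) by (simp add: powr_powr)
      also have "\<dots> \<le> \<eta>" using \<eta> h(1) by (simp add: field_simps)
      finally show ?thesis using x(1) F(1) by blast
    qed
    ultimately show ?thesis by blast
  qed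
  have "\<forall>n. \<exists>f :: 'a \<Rightarrow> real ^ 'k. (k * L)-lipschitz_on X f \<and> f ` X \<subseteq> cbox 0 One \<and>
      (\<forall>y\<in>cbox 0 One. \<exists>x\<in>X. dist (f x) y \<le> 1 / Suc n)"
    using approx by simp
  then obtain f :: "nat \<Rightarrow> 'a \<Rightarrow> real ^ 'k" where f: "\<And>n. (k * L)-lipschitz_on X (f n)" "\<And>n. f n ` X \<subseteq> cbox 0 One"
      "\<And>n y. y \<in> cbox 0 One \<Longrightarrow> \<exists>x\<in>X. dist (f n x) y \<le> 1 / Suc n"
    by metis
  have "\<exists>g. (k * L)-lipschitz_on X g \<and> g ` X = (cbox 0 One :: (real ^ 'k) set)"
    using assms(1) compact_cbox f LIMSEQ_Suc[OF lim_1_over_n] by (rule lipschitz_onto_limit)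
  then show ?thesis by blast
qed

end
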